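(* If Algorithm 3 always follows a core-sequence of length at most $\ell$ and with sets of size at most $n$, then the total number of iterations is \[O\Big(\frac{\ell\log^2(m)\log(\eta n/\varepsilon)}{\varepsilon^4}\Big).\]
   Context: Let $A\in\mathbb{R}^{m\times N}_{\ge0}$ be a nonnegative matrix with no zero column and $\varepsilon>0$; $\eta=\ln(m)/\varepsilon$. Procedure $\mathrm{Focus}_{A,\lambda,\varepsilon}(\tilde B,w,\mathsf{cong})$ (for $\lambda\ge0$, $w,\mathsf{cong}\in\mathbb{R}^m_{\ge0}$, $\tilde B\subseteq\{j:(A^\top w)_j<(1+\varepsilon)\lambda\}$): set a local vector $x=\mathbf 0_N$; while $\|\mathsf{cong}\|_\infty<\eta$ and $\tilde B\ne\emptyset$, perform one iteration: let $\tilde B_0=\{j\in\tilde B:x_j=0\}$; if $\tilde B_0\ne\emptyset$ set $g_j=\varepsilon/(|\tilde B_0|\max_iA_{ij})$ for $j\in\tilde B_0$ and $0$ otherwise; else set $g_j=\delta x_j$ for $j\in\tilde B$ and $0$ otherwise, with $\delta>0$ such that $\|Ag\|_\infty=\varepsilon$; then $x\gets x+g$, $w\gets w\circ(\mathbf 1+Ag)$, $\mathsf{cong}\gets\mathsf{cong}+Ag$, $\tilde B\gets\{j\in\tilde B:(A^\top w)_j<(1+\varepsilon)\lambda\}$. Return $(w,\mathsf{cong})$. Algorithm 3 (MWU with Focus): set $w=\mathbf 1_m$, $\mathsf{cong}=\mathbf 0_m$, $\lambda=\min_j(A^\top w)_j$, $y=w/\lambda$. While $\|\mathsf{cong}\|_\infty<\eta$: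 if $\min_j(A^\top w)_j<(1+\varepsilon)\lambda$, select a subset $\tilde B\subseteq\{j:(A^\top w)_j<(1+\varepsilon)\lambda\}$ and set $(w,\mathsf{cong})\gets\mathrm{Focus}_{A,\lambda,\varepsilon}(\tilde B,w,\mathsf{cong})$; otherwise set $\lambda\gets(1+\varepsilon)\lambda$ (a new epoch) and, if $\langle\mathbf 1,w\rangle/\lambda<\langle\mathbf 1,y\rangle$, set $y\gets w/\lambda$. Return $y$. An epoch is a maximal period during which $\lambda$ is unchanged. Algorithm 3 follows a sequence $(\tilde B_1,\dots,\tilde B_\ell)$ during an epoch if the subsets it selects in successive calls to Focus during the epoch are $\tilde B_1,\dots,\tilde B_\ell$, and this sequence is a core-sequence of the epoch, i.e. after the last of these calls the epoch is cleared: $\min_j(A^\top w)_j\ge(1+\varepsilon)\lambda$. The total number of iterations counts all iterations inside all calls to Focus and all $\lambda$-update steps.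
   Formalization: The O-constant is uniform for ε in any bounded range (0,E] and ηn/ε ≥ κ, with E>0 and κ>1 arbitrary, and depends only on E and κ; without this the bound fails, as the logarithm can be near zero, negative or undefined (m=1). In the final epoch the run may stop before the epoch is cleared. *)

theory Defs
  imports Complex_Main "Jordan_Normal_Form.Matrix"
begin

text \<open>
  The constant in the iteration bound must not depend on the dimensions \<open>m\<close> and \<open>N\<close>, so
  matrices and vectors carry their dimensions as values. Rows and columns are numbered from 0.
\<close>

definition linf_norm :: "real vec \<Rightarrow> real" where
  "linf_norm v = Max (abs ` set\<^sub>v v)"

definition ones :: "nat \<Rightarrow> real vec" where
  "ones m = vec m (\<lambda>_. 1)"

definition nonneg_mat :: "real mat \<Rightarrow> bool" where
  "nonneg_mat A \<longleftrightarrow> (\<forall>i<dim_row A. \<forall>j<dim_col A. 0 \<le> A $$ (i, j))"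

definition no_zero_col :: "real mat \<Rightarrow> bool" where
  "no_zero_col A \<longleftrightarrow> (\<forall>j<dim_col A. col A j \<noteq> 0\<^sub>v (dim_row A))"

definition eta :: "nat \<Rightarrow> real \<Rightarrow> real" where
  "eta m \<epsilon> = ln (real m) / \<epsilon>"

definition min_load :: "real mat \<Rightarrow> real vec \<Rightarrow> real" where
  "min_load A w = Min (set\<^sub>v (transpose_mat A *\<^sub>v w))"

definition light_cols :: "real mat \<Rightarrow> real \<Rightarrow> real \<Rightarrow> real vec \<Rightarrow> nat set" where
  "light_cols A \<epsilon> L w = {j. j < dim_col A \<and> (transpose_mat A *\<^sub>v w) $ j < (1 + \<epsilon>) * L}"

text \<open>
  \<open>focus_increment A \<epsilon> x B g\<close>: \<open>g\<close> is the increment chosen by an iteration of Focus with local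
  vector \<open>x\<close> and current set \<open>B\<close>.
\<close>

definition focus_increment ::
    "real mat \<Rightarrow> real \<Rightarrow> real vec \<Rightarrow> nat set \<Rightarrow> real vec \<Rightarrow> bool" where
  "focus_increment A \<epsilon> x B g \<longleftrightarrow>
     (let B\<^sub>0 = {j \<in> B. x $ j = 0} in
      if B\<^sub>0 \<noteq> {} then
        g = vec (dim_col A)
              (\<lambda>j. if j \<in> B\<^sub>0 then \<epsilon> / (real (card B\<^sub>0) * Max (set\<^sub>v (col A j))) else 0)
      else
        \<exists>\<delta>>0. g = vec (dim_col A) (\<lambda>j. if j \<in> B then \<delta> * x $ j else 0) \<and>
               linf_norm (A *\<^sub>v g) = \<epsilon>)"

text \<open>
  The field \<open>loc\<close> is \<open>None\<close> at the head of the outer loop, and \<open>Some (x, B)\<close> at the head of the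
  loop of Focus, where \<open>x\<close> and \<open>B\<close> are the local variables of the call.
\<close>

record alg_state =
  wt :: "real vec"
  cong :: "real vec"
  lam :: real
  dual :: "real vec"
  loc :: "(real vec \<times> nat set) option"

datatype action = Call "nat set" | Iteration | Return | New_Epoch | Halt

definition init_state :: "real mat \<Rightarrow> alg_state" where
  "init_state A =
     (let w = ones (dim_row A); L = min_load A w in
      \<lparr>wt = w, cong = 0\<^sub>v (dim_row A), lam = L, dual = (1 / L) \<cdot>\<^sub>v w, loc = None\<rparr>)"

inductive alg_step :: "real mat \<Rightarrow> real \<Rightarrow> alg_state \<Rightarrow> action \<Rightarrow> alg_state \<Rightarrow> bool"
  for A :: "real mat" and \<epsilon> :: real where
  call:
    "\<lbrakk>loc s = None; linf_norm (cong s) < eta (dim_row A) \<epsilon>;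
      min_load A (wt s) < (1 + \<epsilon>) * lam s;
      B \<subseteq> light_cols A \<epsilon> (lam s) (wt s)\<rbrakk>
     \<Longrightarrow> alg_step A \<epsilon> s (Call B) (s\<lparr>loc := Some (0\<^sub>v (dim_col A), B)\<rparr>)"
| iteration:
    "\<lbrakk>loc s = Some (x, B); linf_norm (cong s) < eta (dim_row A) \<epsilon>; B \<noteq> {};
      focus_increment A \<epsilon> x B g;
      w' = vec (dim_row A) (\<lambda>i. wt s $ i * (1 + (A *\<^sub>v g) $ i))\<rbrakk>
     \<Longrightarrow> alg_step A \<epsilon> s Iteration
           (s\<lparr>wt := w', cong := cong s + A *\<^sub>v g,
              loc := Some (x + g, B \<inter> light_cols A \<epsilon> (lam s) w')\<rparr>)"
| return:
    "\<lbrakk>loc s = Some (x, B); \<not> (linf_norm (cong s) < eta (dim_row A) \<epsilon> \<and> B \<noteq> {})\<rbrakk>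
     \<Longrightarrow> alg_step A \<epsilon> s Return (s\<lparr>loc := None\<rparr>)"
| new_epoch:
    "\<lbrakk>loc s = None; linf_norm (cong s) < eta (dim_row A) \<epsilon>;
      \<not> min_load A (wt s) < (1 + \<epsilon>) * lam s;
      L' = (1 + \<epsilon>) * lam s;
      y' = (if (ones (dim_row A) \<bullet> wt s) / L' < ones (dim_row A) \<bullet> dual s
            then (1 / L') \<cdot>\<^sub>v wt s else dual s)\<rbrakk>
     \<Longrightarrow> alg_step A \<epsilon> s New_Epoch (s\<lparr>lam := L', dual := y'\<rparr>)"
| halt:
    "\<lbrakk>loc s = None; \<not> linf_norm (cong s) < eta (dim_row A) \<epsilon>\<rbrakk>
     \<Longrightarrow> alg_step A \<epsilon> s Halt s"

text \<open>
  A terminated execution is continued by \<open>Halt\<close> steps forever; termination is not presupposed.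
\<close>

definition execution ::
    "real mat \<Rightarrow> real \<Rightarrow> (nat \<Rightarrow> alg_state) \<Rightarrow> (nat \<Rightarrow> action) \<Rightarrow> bool" where
  "execution A \<epsilon> \<sigma> \<alpha> \<longleftrightarrow>
     \<sigma> 0 = init_state A \<and> (\<forall>t. alg_step A \<epsilon> (\<sigma> t) (\<alpha> t) (\<sigma> (Suc t)))"

text \<open>
  Since \<open>lam\<close> is positive and only changes by a factor \<open>1 + \<epsilon> > 1\<close>, an epoch is identified with the
  value of \<open>lam\<close> in it.
\<close>

definition call_times ::
    "(nat \<Rightarrow> alg_state) \<Rightarrow> (nat \<Rightarrow> action) \<Rightarrow> real \<Rightarrow> nat set" where
  "call_times \<sigma> \<alpha> L = {t. lam (\<sigma> t) = L \<and> (\<exists>B. \<alpha> t = Call B)}"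

definition selects ::
    "(nat \<Rightarrow> alg_state) \<Rightarrow> (nat \<Rightarrow> action) \<Rightarrow> real \<Rightarrow> nat set list \<Rightarrow> bool" where
  "selects \<sigma> \<alpha> L Bs \<longleftrightarrow>
     (\<exists>ts. sorted_wrt (<) ts \<and> set ts = call_times \<sigma> \<alpha> L \<and> map \<alpha> ts = map Call Bs)"

text \<open>
  Once the last call of the epoch has returned, the epoch is cleared. The disjunct about the
  congestion concerns the final epoch only: the algorithm may stop there, inside a call, before
  the epoch is cleared.
\<close>

definition cleared_after_calls ::
    "real mat \<Rightarrow> real \<Rightarrow> (nat \<Rightarrow> alg_state) \<Rightarrow> (nat \<Rightarrow> action) \<Rightarrow> real \<Rightarrow> bool" where
  "cleared_after_calls A \<epsilon> \<sigma> \<alpha> L \<longleftrightarrow>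
     (\<forall>t. lam (\<sigma> t) = L \<and> loc (\<sigma> t) = None \<and> (\<forall>t'\<in>call_times \<sigma> \<alpha> L. t' < t) \<longrightarrow>
        min_load A (wt (\<sigma> t)) \<ge> (1 + \<epsilon>) * L \<or>
        linf_norm (cong (\<sigma> t)) \<ge> eta (dim_row A) \<epsilon>)"

definition follows_core_sequence ::
    "real mat \<Rightarrow> real \<Rightarrow> (nat \<Rightarrow> alg_state) \<Rightarrow> (nat \<Rightarrow> action) \<Rightarrow> real \<Rightarrow> nat set list \<Rightarrow> bool"
  where
  "follows_core_sequence A \<epsilon> \<sigma> \<alpha> L Bs \<longleftrightarrow>
     selects \<sigma> \<alpha> L Bs \<and> cleared_after_calls A \<epsilon> \<sigma> \<alpha> L"

definition always_follows_core_sequences ::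
    "real mat \<Rightarrow> real \<Rightarrow> (nat \<Rightarrow> alg_state) \<Rightarrow> (nat \<Rightarrow> action) \<Rightarrow> nat \<Rightarrow> nat \<Rightarrow> bool" where
  "always_follows_core_sequences A \<epsilon> \<sigma> \<alpha> l n \<longleftrightarrow>
     (\<forall>L\<in>range (\<lambda>t. lam (\<sigma> t)).
        \<exists>Bs. follows_core_sequence A \<epsilon> \<sigma> \<alpha> L Bs \<and> length Bs \<le> l \<and> (\<forall>B\<in>set Bs. card B \<le> n))"

definition iteration_times :: "(nat \<Rightarrow> action) \<Rightarrow> nat set" where
  "iteration_times \<alpha> = {t. \<alpha> t = Iteration \<or> \<alpha> t = New_Epoch}"

end

theory Submission
  imports Defs
begin

text \<open>
  Every weight is at most the exponential of the corresponding congestion, which never exceeds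
  \<open>\<eta> + \<epsilon>\<close>. As \<open>\<lambda>\<close> is a lower bound for all loads, it grows by a factor of at most
  \<open>exp (\<eta> + \<epsilon>)\<close> altogether, which bounds the number of epochs by \<open>(\<eta> + \<epsilon>) / ln (1 + \<epsilon>)\<close>.
  Within one call of Focus, the first iteration gives every \<open>j\<close> in the selected set the value
  \<open>x\<^sub>j max\<^sub>i A\<^sub>i\<^sub>j \<ge> \<epsilon> / n\<close>. Each later iteration has \<open>\<delta> \<ge> \<epsilon> / \<eta>\<close>, because
  \<open>\<epsilon> = \<parallel>A g\<parallel> \<le> \<delta> \<parallel>A x\<parallel> \<le> \<delta> \<eta>\<close>, so the value grows by a factor of at least \<open>1 + \<epsilon> / \<eta>\<close> for as
  long as \<open>j\<close> remains in the set. Since \<open>x\<^sub>j max\<^sub>i A\<^sub>i\<^sub>j \<le> \<parallel>cong\<parallel> < \<eta>\<close>, this happens at most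
  \<open>ln (\<eta> n / \<epsilon>) / ln (1 + \<epsilon> / \<eta>) + 1\<close> times.
\<close>

section \<open>Coordinates of matrix-vector products and the maximum norm\<close>

lemma mult_mat_vec_nth_sum:
  assumes "A \<in> carrier_mat m N" "x \<in> carrier_vec N" "i < m"
  shows "(A *\<^sub>v x) $ i = (\<Sum>j<N. A $$ (i, j) * x $ j)"
  using assms by (auto simp: scalar_prod_def lessThan_atLeast0 intro!: sum.cong)

lemma transpose_mult_vec_nth_sum:
  assumes "A \<in> carrier_mat m N" "w \<in> carrier_vec m" "j < N"
  shows "(transpose_mat A *\<^sub>v w) $ j = (\<Sum>i<m. A $$ (i, j) * w $ i)"
  using assms by (auto simp: scalar_prod_def lessThan_atLeast0 intro!: sum.cong)

lemma finite_vec_set: "finite (set\<^sub>v v)"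
  by (simp add: vec_set_def)

lemma vec_nth_le_linf_norm: "i < dim_vec v \<Longrightarrow> v $ i \<le> linf_norm v"
proof -
  assume "i < dim_vec v"
  then have "\<bar>v $ i\<bar> \<le> linf_norm v"
    unfolding linf_norm_def by (intro Max_ge) (auto simp: finite_vec_set vec_set_def)
  then show ?thesis by linarith
qed

lemma linf_norm_attained:
  assumes "0 < dim_vec v"
  obtains i where "i < dim_vec v" "linf_norm v = \<bar>v $ i\<bar>"
proof -
  have "linf_norm v \<in> abs ` set\<^sub>v v"
    unfolding linf_norm_def using assms
    by (intro Max_in) (auto simp: finite_vec_set vec_set_def)
  then show ?thesis using that by (auto simp: vec_set_def)
qed

section \<open>Logarithm estimates\<close>

lemma inverse_ln_one_plus_le:
  fixes y :: real
  assumes "0 < y"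
  shows "1 / ln (1 + y) \<le> 1 + 1 / y"
proof -
  \<comment> \<open>The inequality \<open>ln z \<le> z - 1\<close> is taken at the reciprocal of
    \<open>1 + y\<close>, so that it bounds \<open>ln (1 + y)\<close> from below.\<close>
  have "ln (1 / (1 + y)) \<le> 1 / (1 + y) - 1"
    using assms by (intro ln_le_minus_one) simp
  then have "y / (1 + y) \<le> ln (1 + y)"
    using assms by (simp add: ln_div field_simps)
  then have "1 / ln (1 + y) \<le> 1 / (y / (1 + y))"
    using assms by (intro divide_left_mono mult_pos_pos) auto
  then show ?thesis using assms by (simp add: field_simps)
qed

lemma power_le_imp_exponent_le:
  fixes b z :: real
  assumes "1 < b" "b ^ k \<le> z"
  shows "real k \<le> ln z / ln b"
proof -
  have "0 < b ^ k" using assms by simp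
  then have "ln (b ^ k) \<le> ln z" using assms by (intro ln_mono) auto
  then show ?thesis using assms by (simp add: ln_realpow field_simps)
qed

section \<open>Counting actions in finite prefixes of an execution\<close>

definition occurrences :: "('a \<Rightarrow> bool) \<Rightarrow> (nat \<Rightarrow> 'a) \<Rightarrow> nat \<Rightarrow> nat" where
  "occurrences Q \<alpha> t = card {u. u < t \<and> Q (\<alpha> u)}"

lemma occurrences_0 [simp]: "occurrences Q \<alpha> 0 = 0"
  by (simp add: occurrences_def)

lemma occurrences_Suc [simp]:
  "occurrences Q \<alpha> (Suc t) = occurrences Q \<alpha> t + (if Q (\<alpha> t) then 1 else 0)"
proof -
  have "{u. u < Suc t \<and> Q (\<alpha> u)} = (if Q (\<alpha> t) then {t} else {}) \<union> {u. u < t \<and> Q (\<alpha> u)}"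
    by (auto simp: less_Suc_eq)
  then show ?thesis by (simp add: occurrences_def)
qed

text \<open>Every finite set of such times lies in some prefix, so a bound uniform over prefixes
  bounds all finite subsets. This is how finiteness is derived without presupposing
  termination.\<close>

lemma finite_card_le_if_occurrences_le:
  assumes "\<And>t. real (occurrences Q \<alpha> t) \<le> T"
  shows "finite {t. Q (\<alpha> t)} \<and> real (card {t. Q (\<alpha> t)}) \<le> T"
proof -
  have bound: "card F \<le> nat \<lfloor>T\<rfloor>" if F: "finite F" "F \<subseteq> {t. Q (\<alpha> t)}" for F
  proof -
    \<comment> \<open>For \<open>F = {}\<close> the value of \<open>Max F\<close> is unspecified,
      but the inclusion is trivial.\<close>
    have "F \<subseteq> {u. u < Suc (Max F) \<and> Q (\<alpha> u)}"
      using F by (auto simp: less_Suc_eq_le)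
    then have "card F \<le> occurrences Q \<alpha> (Suc (Max F))"
      unfolding occurrences_def by (intro card_mono) auto
    then show ?thesis using assms[of "Suc (Max F)"] by linarith
  qed
  have "0 \<le> T" using assms[of 0] by simp
  then show ?thesis
    using finite_if_finite_subsets_card_bdd[of "{t. Q (\<alpha> t)}" "nat \<lfloor>T\<rfloor>"] bound
    by (smt (verit, best) of_nat_floor of_nat_le_iff)
qed

lemma selects_imp:
  assumes "selects \<sigma> \<alpha> L Bs"
  shows "finite (call_times \<sigma> \<alpha> L)"
    and "card (call_times \<sigma> \<alpha> L) \<le> length Bs"
    and "lam (\<sigma> t) = L \<Longrightarrow> \<alpha> t = Call B \<Longrightarrow> B \<in> set Bs"
proof -
  obtain ts where ts: "set ts = call_times \<sigma> \<alpha> L" "map \<alpha> ts = map Call Bs"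
    using assms by (auto simp: selects_def)
  show "finite (call_times \<sigma> \<alpha> L)" using ts(1) by (metis finite_set)
  show "card (call_times \<sigma> \<alpha> L) \<le> length Bs"
    using ts card_length[of ts] by (metis length_map)
  assume "lam (\<sigma> t) = L" "\<alpha> t = Call B"
  then have "t \<in> set ts" by (simp add: ts call_times_def)
  then have "Call B \<in> \<alpha> ` set ts" using \<open>\<alpha> t = Call B\<close> by force
  also have "\<alpha> ` set ts = Call ` set Bs" using ts(2) by (metis set_map)
  finally show "B \<in> set Bs" by auto
qed

section \<open>Positivity facts for a fixed instance\<close>

locale focus_instance =
  fixes m N n :: nat and A :: "real mat" and \<epsilon> :: real
  assumes A_carrier: "A \<in> carrier_mat m N"
    and N_pos: "0 < N"
    and A_nonneg: "nonneg_mat A"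
    and A_col: "no_zero_col A"
    and eps_pos: "0 < \<epsilon>"
    and ratio_gt_1: "1 < eta m \<epsilon> * real n / \<epsilon>"
begin

abbreviation \<eta> :: real where "\<eta> \<equiv> eta m \<epsilon>"

abbreviation colmax :: "nat \<Rightarrow> real" where "colmax j \<equiv> Max (set\<^sub>v (col A j))"

lemma dims [simp]: "dim_row A = m" "dim_col A = N"
  using A_carrier by auto

lemma entry_nonneg: "i < m \<Longrightarrow> j < N \<Longrightarrow> 0 \<le> A $$ (i, j)"
  using A_nonneg by (simp add: nonneg_mat_def)

text \<open>If \<open>ln m\<close> were 0, so would be the ratio in \<open>ratio_gt_1\<close>. The
  case \<open>m = 0\<close> is covered by the convention \<open>ln 0 = 0\<close>; thus
  \<open>ratio_gt_1\<close> alone yields \<open>m \<ge> 2\<close>, \<open>\<eta> > 0\<close> and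
  \<open>n > 0\<close>.\<close>

lemma ln_m_pos: "0 < ln (real m)"
proof -
  have "ln (real m) \<noteq> 0" using ratio_gt_1 by (auto simp: eta_def)
  moreover have "0 \<le> ln (real m)" by (cases "m = 0") auto
  ultimately show ?thesis by simp
qed

lemma m_ge_2: "2 \<le> m"
proof (rule ccontr)
  assume "\<not> 2 \<le> m"
  then have "m = 0 \<or> m = 1" by linarith
  then show False using ln_m_pos by auto
qed

lemma eta_pos: "0 < \<eta>"
  using ln_m_pos eps_pos by (simp add: eta_def)

lemma n_pos: "0 < n"
  using ratio_gt_1 by (cases n) auto

lemma entry_le_colmax: "i < m \<Longrightarrow> j < N \<Longrightarrow> A $$ (i, j) \<le> colmax j"
  by (intro Max_ge finite_vec_set) (auto simp: vec_set_def intro!: exI[of _ i])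

lemma colmax_attained:
  assumes "j < N"
  obtains i where "i < m" "colmax j = A $$ (i, j)"
proof -
  have "colmax j \<in> set\<^sub>v (col A j)"
    using m_ge_2 by (intro Max_in finite_vec_set) (auto simp: vec_set_def lessThan_empty_iff)
  then show ?thesis using that assms by (auto simp: vec_set_def)
qed

lemma positive_entry:
  assumes "j < N"
  obtains i where "i < m" "0 < A $$ (i, j)"
proof -
  have "col A j \<noteq> 0\<^sub>v m" using A_col assms by (simp add: no_zero_col_def)
  then obtain i where "i < m" "A $$ (i, j) \<noteq> 0"
    using assms by (auto simp: vec_eq_iff)
  then show ?thesis using that entry_nonneg[of i j] assms by force
qed

lemma colmax_pos: "j < N \<Longrightarrow> 0 < colmax j"
  by (meson entry_le_colmax less_le_trans positive_entry)

lemma mult_vec_nonneg: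
  assumes "x \<in> carrier_vec N" "\<forall>j<N. 0 \<le> x $ j" "i < m"
  shows "0 \<le> (A *\<^sub>v x) $ i"
  unfolding mult_mat_vec_nth_sum[OF A_carrier assms(1,3)]
  using assms entry_nonneg[OF assms(3)] by (intro sum_nonneg mult_nonneg_nonneg) auto

lemma load_mono:
  assumes "v \<in> carrier_vec m" "w \<in> carrier_vec m" "\<And>i. i < m \<Longrightarrow> v $ i \<le> w $ i" "j < N"
  shows "(transpose_mat A *\<^sub>v v) $ j \<le> (transpose_mat A *\<^sub>v w) $ j"
  using assms entry_nonneg unfolding transpose_mult_vec_nth_sum[OF A_carrier assms(1,4)]
    transpose_mult_vec_nth_sum[OF A_carrier assms(2,4)]
  by (intro sum_mono mult_left_mono) auto

lemma min_load_le: "j < N \<Longrightarrow> min_load A w \<le> (transpose_mat A *\<^sub>v w) $ j"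
  unfolding min_load_def
  by (intro Min_le finite_vec_set) (auto simp: vec_set_def intro!: exI[of _ j])

lemma min_load_attained:
  obtains j where "j < N" "min_load A w = (transpose_mat A *\<^sub>v w) $ j"
proof -
  have "min_load A w \<in> set\<^sub>v (transpose_mat A *\<^sub>v w)"
    unfolding min_load_def using N_pos by (intro Min_in finite_vec_set) (auto simp: vec_set_def)
  then show ?thesis using that by (auto simp: vec_set_def)
qed

text \<open>The value of \<lambda> in the first epoch. All later values are its multiples by powers
  of \<open>1 + \<epsilon>\<close>.\<close>

definition init_lam :: real where "init_lam = min_load A (ones m)"

lemma ones_carrier: "ones m \<in> carrier_vec m"
  by (simp add: ones_def)

lemma ones_load: "j < N \<Longrightarrow> (transpose_mat A *\<^sub>v ones m) $ j = (\<Sum>i<m. A $$ (i, j))"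
  unfolding transpose_mult_vec_nth_sum[OF A_carrier ones_carrier] by (simp add: ones_def)

lemma init_lam_pos: "0 < init_lam"
proof -
  obtain j where j: "j < N" "init_lam = (transpose_mat A *\<^sub>v ones m) $ j"
    unfolding init_lam_def by (rule min_load_attained)
  obtain i where "i < m" "0 < A $$ (i, j)" using positive_entry j(1) .
  then have "0 < (\<Sum>i<m. A $$ (i, j))"
    using entry_nonneg j(1) by (intro sum_pos2[of _ i]) auto
  then show ?thesis using j ones_load by simp
qed

section \<open>Size of a single increment\<close>

lemma focus_increment_bounds:
  assumes inc: "focus_increment A \<epsilon> x B g"
    and x: "x \<in> carrier_vec N" "\<forall>j<N. 0 \<le> x $ j"
    and B: "B \<subseteq> {..<N}"
  shows "g \<in> carrier_vec N"
    and "j < N \<Longrightarrow> 0 \<le> g $ j"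
    and "i < m \<Longrightarrow> (A *\<^sub>v g) $ i \<le> \<epsilon>"
proof -
  define B0 where "B0 = {j \<in> B. x $ j = 0}"
  have fin: "finite B0" using B by (auto simp: B0_def intro: finite_subset)
  have "g \<in> carrier_vec N \<and> (\<forall>j<N. 0 \<le> g $ j) \<and> (\<forall>i<m. (A *\<^sub>v g) $ i \<le> \<epsilon>)"
  proof (cases "B0 = {}")
    case False
    then have g: "g = vec N (\<lambda>j. if j \<in> B0 then \<epsilon> / (real (card B0) * colmax j) else 0)"
      using inc unfolding focus_increment_def Let_def B0_def[symmetric] by simp
    then have gc: "g \<in> carrier_vec N" by simp
    have "(A *\<^sub>v g) $ i \<le> \<epsilon>" if i: "i < m" for i
    proof -
      \<comment> \<open>Each column of \<open>B0\<close> receives an equal share of \<epsilon>: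
        dividing by \<open>colmax j\<close> caps its contribution to any row at
        \<open>\<epsilon> / card B0\<close>.\<close>
      have "A $$ (i, j) * g $ j \<le> (if j \<in> B0 then \<epsilon> / real (card B0) else 0)" if j: "j < N" for j
      proof (cases "j \<in> B0")
        case True
        have "A $$ (i, j) * g $ j = (\<epsilon> / real (card B0)) * (A $$ (i, j) / colmax j)"
          using True j by (simp add: g)
        also have "\<dots> \<le> (\<epsilon> / real (card B0)) * 1"
          using entry_le_colmax[OF i j] colmax_pos[OF j] eps_pos
          by (intro mult_left_mono) (auto simp: divide_le_eq_1)
        finally show ?thesis using True by simp
      qed (use j in \<open>simp add: g\<close>)
      then have "(A *\<^sub>v g) $ i \<le> (\<Sum>j<N. if j \<in> B0 then \<epsilon> / real (card B0) else 0)"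
        unfolding mult_mat_vec_nth_sum[OF A_carrier gc i] by (intro sum_mono) auto
      also have "\<dots> = (\<Sum>j\<in>{..<N} \<inter> B0. \<epsilon> / real (card B0))"
        by (rule sum.inter_restrict[symmetric]) simp
      also have "{..<N} \<inter> B0 = B0" using B by (auto simp: B0_def)
      finally show ?thesis using False fin by simp
    qed
    moreover have "0 \<le> g $ j" if "j < N" for j
      using that eps_pos colmax_pos[OF that] by (simp add: g)
    ultimately show ?thesis using gc by blast
  next
    case True
    then obtain \<delta> where "0 < \<delta>" and g: "g = vec N (\<lambda>j. if j \<in> B then \<delta> * x $ j else 0)"
      and norm: "linf_norm (A *\<^sub>v g) = \<epsilon>"
      using inc by (auto simp: focus_increment_def B0_def Let_def)
    moreover have "(A *\<^sub>v g) $ i \<le> \<epsilon>" if "i < m" for i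
      using vec_nth_le_linf_norm[of i "A *\<^sub>v g"] that norm by simp
    ultimately show ?thesis using x by simp
  qed
  then show "g \<in> carrier_vec N" "j < N \<Longrightarrow> 0 \<le> g $ j" "i < m \<Longrightarrow> (A *\<^sub>v g) $ i \<le> \<epsilon>"
    by auto
qed

text \<open>At \<open>x = 0\<close> all of \<open>B\<close> is still untouched, so the share of each
  column is \<open>\<epsilon> / card B\<close>, and \<open>card B \<le> n\<close>.\<close>

lemma first_increment:
  assumes inc: "focus_increment A \<epsilon> (0\<^sub>v N) B g"
    and B: "B \<subseteq> {..<N}" "card B \<le> n" "j \<in> B"
  shows "\<epsilon> / real n \<le> g $ j * colmax j"
proof -
  have "{k \<in> B. 0\<^sub>v N $ k = (0 :: real)} = B" "B \<noteq> {}" using B by auto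
  then have g: "g = vec N (\<lambda>j. if j \<in> B then \<epsilon> / (real (card B) * colmax j) else 0)"
    using inc by (simp add: focus_increment_def Let_def)
  have "card B > 0" using B finite_subset[OF B(1)] by (auto simp: card_gt_0_iff)
  have "j < N" using B by auto
  have "\<epsilon> / real n \<le> \<epsilon> / real (card B)"
    using \<open>card B > 0\<close> B eps_pos by (intro divide_left_mono) auto
  also have "\<dots> = g $ j * colmax j"
    using \<open>j < N\<close> B(3) colmax_pos[OF \<open>j < N\<close>] by (simp add: g)
  finally show ?thesis .
qed

lemma later_increment:
  assumes inc: "focus_increment A \<epsilon> x B g"
    and x: "x \<in> carrier_vec N" "\<forall>j<N. 0 \<le> x $ j" "\<And>j. j \<in> B \<Longrightarrow> 0 < x $ j"
    and B: "B \<subseteq> {..<N}" "j \<in> B"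
    and Ax: "\<And>i. i < m \<Longrightarrow> (A *\<^sub>v x) $ i \<le> \<eta>"
  shows "\<epsilon> / \<eta> * x $ j \<le> g $ j"
proof -
  have "{k \<in> B. x $ k = 0} = {}" using x(3) by force
  then obtain \<delta> where \<delta>: "0 < \<delta>" and g: "g = vec N (\<lambda>j. if j \<in> B then \<delta> * x $ j else 0)"
    and norm: "linf_norm (A *\<^sub>v g) = \<epsilon>"
    using inc by (auto simp: focus_increment_def Let_def)
  obtain i where i: "i < m" "\<epsilon> = \<bar>(A *\<^sub>v g) $ i\<bar>"
    using linf_norm_attained[of "A *\<^sub>v g"] norm m_ge_2 by auto
  have gc: "g \<in> carrier_vec N" by (simp add: g)
  have "0 \<le> (A *\<^sub>v g) $ i"
    using x \<delta> by (intro mult_vec_nonneg[OF gc _ i(1)]) (auto simp: g)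
  then have "\<epsilon> = (A *\<^sub>v g) $ i" using i by simp
  \<comment> \<open>Columns outside \<open>B\<close> are added to the sum; this is harmless since
    all entries are nonnegative, and it turns the sum into a row of
    \<open>A *\<^sub>v x\<close>.\<close>
  also have "\<dots> \<le> (\<Sum>j<N. \<delta> * (A $$ (i, j) * x $ j))"
    unfolding mult_mat_vec_nth_sum[OF A_carrier gc i(1)]
    using x(2) \<delta> entry_nonneg[OF i(1)] by (intro sum_mono) (auto simp: g)
  also have "\<dots> = \<delta> * (A *\<^sub>v x) $ i"
    unfolding mult_mat_vec_nth_sum[OF A_carrier x(1) i(1)] by (simp add: sum_distrib_left)
  also have "\<dots> \<le> \<delta> * \<eta>" using Ax[OF i(1)] \<delta> by simp
  finally have "\<epsilon> / \<eta> \<le> \<delta>" using eta_pos by (simp add: field_simps)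
  moreover have "j < N" using B by auto
  ultimately show ?thesis using B x(2) by (simp add: g mult_right_mono del: times_divide_eq_left)
qed

section \<open>Iterations within one call of Focus\<close>

definition call_bound :: real where
  "call_bound = 2 + ln (\<eta> * real n / \<epsilon>) / ln (1 + \<epsilon> / \<eta>)"

text \<open>\<open>r\<close> is the number of iterations performed so far in the current call.\<close>

definition focus_inv :: "nat \<Rightarrow> real vec \<Rightarrow> real vec \<Rightarrow> nat set \<Rightarrow> bool" where
  "focus_inv r v x B \<longleftrightarrow>
     real r \<le> call_bound \<and> x \<in> carrier_vec N \<and> B \<subseteq> {..<N} \<and> card B \<le> n \<and>
     (\<forall>j<N. 0 \<le> x $ j) \<and> (\<forall>i<m. (A *\<^sub>v x) $ i \<le> v $ i) \<and>
     (if r = 0 then x = 0\<^sub>v N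
      else \<forall>j\<in>B. (1 + \<epsilon> / \<eta>) ^ (r - 1) * (\<epsilon> / real n) \<le> x $ j * colmax j)"

lemma call_bound_ge_2: "2 \<le> call_bound"
  using ratio_gt_1 eps_pos eta_pos by (simp add: call_bound_def)

lemma entry_mult_le_mult_vec:
  assumes "x \<in> carrier_vec N" "\<forall>j<N. 0 \<le> x $ j" "i < m" "j < N"
  shows "A $$ (i, j) * x $ j \<le> (A *\<^sub>v x) $ i"
  unfolding mult_mat_vec_nth_sum[OF A_carrier assms(1,3)]
  using assms entry_nonneg[OF assms(3)]
  by (intro member_le_sum[of j "{..<N}" "\<lambda>j. A $$ (i, j) * x $ j"]) auto

lemma focus_inv_step:
  assumes inv: "focus_inv r v x B"
    and v: "v \<in> carrier_vec m" "\<And>i. i < m \<Longrightarrow> v $ i < \<eta>"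
    and B: "B \<noteq> {}" "B' \<subseteq> B"
    and inc: "focus_increment A \<epsilon> x B g"
  shows "focus_inv (Suc r) (v + A *\<^sub>v g) (x + g) B'"
proof -
  from inv have x: "x \<in> carrier_vec N" "\<forall>j<N. 0 \<le> x $ j"
    and BN: "B \<subseteq> {..<N}" "card B \<le> n"
    and Ax: "\<And>i. i < m \<Longrightarrow> (A *\<^sub>v x) $ i \<le> v $ i"
    by (auto simp: focus_inv_def)
  note g = focus_increment_bounds[OF inc x BN(1)]
  define b where "b = 1 + \<epsilon> / \<eta>"
  have b: "1 < b" using eps_pos eta_pos by (simp add: b_def)
  have pos: "0 < b ^ k * (\<epsilon> / real n)" for k
    using b eps_pos n_pos by simp
  have "card B' \<le> n" using BN B card_mono[OF finite_subset[OF BN(1)] B(2)] by simp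
  moreover have "(A *\<^sub>v (x + g)) $ i \<le> (v + A *\<^sub>v g) $ i" if i: "i < m" for i
  proof -
    have "A *\<^sub>v (x + g) = A *\<^sub>v x + A *\<^sub>v g"
      using mult_add_distrib_mat_vec[OF A_carrier x(1) g(1)] .
    then show ?thesis using Ax[OF i] i v(1) by simp
  qed
  \<comment> \<open>The growth is shown on the set before the iteration; the columns that survive
    into \<open>B'\<close> inherit it.\<close>
  moreover have "real (Suc r) \<le> call_bound \<and>
      (\<forall>j\<in>B. b ^ r * (\<epsilon> / real n) \<le> (x + g) $ j * colmax j)"
  proof (cases "r = 0")
    case True
    then have "x = 0\<^sub>v N" using inv by (simp add: focus_inv_def)
    then have "\<epsilon> / real n \<le> (x + g) $ j * colmax j" if "j \<in> B" for j
      using first_increment[of B g j] inc BN that g(1) by auto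
    then show ?thesis using True call_bound_ge_2 by simp
  next
    case False
    then obtain q where q: "r = Suc q" by (cases r) auto
    then have grown: "b ^ q * (\<epsilon> / real n) \<le> x $ j * colmax j" if "j \<in> B" for j
      using inv that by (simp add: focus_inv_def b_def)
    \<comment> \<open>From the second iteration on, no column of \<open>B\<close> has value 0, so
      the multiplicative rule applies.\<close>
    have x_pos: "0 < x $ j" if "j \<in> B" for j
      using grown[OF that] pos[of q] colmax_pos[of j] BN that
      by (smt (verit) lessThan_iff mult_nonpos_nonneg subsetD)
    \<comment> \<open>One surviving column suffices to bound the iteration count: in the row
      attaining its maximum, its value is a lower bound for the congestion.\<close>
    obtain j where "j \<in> B" using B by auto
    then have "j < N" using BN by auto
    then obtain i where i: "i < m" "colmax j = A $$ (i, j)" by (rule colmax_attained)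
    have "b ^ q * (\<epsilon> / real n) \<le> A $$ (i, j) * x $ j"
      using grown[OF \<open>j \<in> B\<close>] i by (simp add: mult.commute)
    also have "\<dots> \<le> (A *\<^sub>v x) $ i"
      using entry_mult_le_mult_vec[OF x i(1) \<open>j < N\<close>] .
    also have "\<dots> \<le> \<eta>" using Ax[OF i(1)] v(2)[OF i(1)] by simp
    finally have "b ^ q \<le> \<eta> * real n / \<epsilon>" using eps_pos n_pos by (simp add: field_simps)
    then have "real q \<le> ln (\<eta> * real n / \<epsilon>) / ln b" by (rule power_le_imp_exponent_le[OF b])
    \<comment> \<open>Here \<open>Suc r = q + 2\<close>. The summand 2 in \<open>call_bound\<close>
      pays for the first iteration, which starts the growth, and for the present one, whose growth
      is not yet bounded by \<eta>.\<close>
    then have "real (Suc r) \<le> call_bound" by (simp add: q call_bound_def b_def)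
    moreover have "b ^ r * (\<epsilon> / real n) \<le> (x + g) $ j * colmax j" if "j \<in> B" for j
    proof -
      have "j < N" using BN that by auto
      have "b ^ r * (\<epsilon> / real n) = b * (b ^ q * (\<epsilon> / real n))" by (simp add: q)
      also have "\<dots> \<le> b * (x $ j * colmax j)"
        using grown[OF that] b by (intro mult_left_mono) auto
      also have "\<dots> = (x $ j + \<epsilon> / \<eta> * x $ j) * colmax j"
        by (simp add: b_def algebra_simps)
      also have "\<dots> \<le> (x $ j + g $ j) * colmax j"
      proof (intro mult_right_mono add_left_mono)
        show "\<epsilon> / \<eta> * x $ j \<le> g $ j"
          using Ax v(2) by (intro later_increment[OF inc x x_pos BN(1) that]) force+
        show "0 \<le> colmax j" using colmax_pos[OF \<open>j < N\<close>] by simp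
      qed
      finally show ?thesis using \<open>j < N\<close> x(1) g(1) by simp
    qed
    ultimately show ?thesis by blast
  qed
  ultimately show ?thesis
    using x g BN B by (auto simp: focus_inv_def b_def)
qed

section \<open>Invariants of the whole execution\<close>

definition weight_inv :: "nat \<Rightarrow> alg_state \<Rightarrow> bool" where
  \<comment> \<open>The parameter \<open>e\<close> is the number of epoch changes so far. The slack
    \<epsilon> above \<eta> is the most that one iteration adds to a congestion that was below
    \<eta> when the loop test was passed.\<close>
  "weight_inv e s \<longleftrightarrow>
     wt s \<in> carrier_vec m \<and> cong s \<in> carrier_vec m \<and>
     (\<forall>i<m. 0 \<le> wt s $ i \<and> wt s $ i \<le> exp (cong s $ i) \<and>
        0 \<le> cong s $ i \<and> cong s $ i \<le> \<eta> + \<epsilon>) \<and>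
     lam s = init_lam * (1 + \<epsilon>) ^ e \<and> (\<forall>j<N. lam s \<le> (transpose_mat A *\<^sub>v wt s) $ j)"

text \<open>An amortised count for \<open>k\<close> iterations in \<open>c\<close> calls. During an
  open call, the completed \<open>c - 1\<close> calls are charged \<open>call_bound\<close> each and
  the open one its actual \<open>r\<close> iterations; the subtraction is moved to the left-hand
  side.\<close>

definition call_inv :: "nat \<Rightarrow> nat \<Rightarrow> alg_state \<Rightarrow> bool" where
  "call_inv c k s \<longleftrightarrow>
     (case loc s of
        None \<Rightarrow> real k \<le> call_bound * real c
      | Some (x, B) \<Rightarrow>
          \<exists>r. real k + call_bound \<le> call_bound * real c + real r \<and> focus_inv r (cong s) x B)"

lemma weight_inv_init: "weight_inv 0 (init_state A)"
  using eta_pos eps_pos min_load_le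
  by (auto simp: weight_inv_def init_state_def Let_def init_lam_def ones_def)

lemma call_inv_init: "call_inv 0 0 (init_state A)"
  by (simp add: call_inv_def init_state_def Let_def)

lemma congestion_lt:
  assumes "linf_norm v < \<eta>" "v \<in> carrier_vec m" "i < m"
  shows "v $ i < \<eta>"
  using vec_nth_le_linf_norm[of i v] assms by auto

lemma inv_step:
  assumes step: "alg_step A \<epsilon> s a s'"
    and w: "weight_inv e s"
    and c: "call_inv c k s"
    and small: "\<And>B. a = Call B \<Longrightarrow> card B \<le> n"
  shows "weight_inv (e + (if a = New_Epoch then 1 else 0)) s' \<and>
         call_inv (c + (if \<exists>B. a = Call B then 1 else 0)) (k + (if a = Iteration then 1 else 0)) s'"
  using step
proof cases
  case (call B)
  have "B \<subseteq> {..<N}" using call by (auto simp: light_cols_def)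
  moreover have "(A *\<^sub>v 0\<^sub>v N) $ i = 0" if "i < m" for i
    using that mult_mat_vec_nth_sum[OF A_carrier, of "0\<^sub>v N" i] by simp
  ultimately have "focus_inv 0 (cong s) (0\<^sub>v N) B"
    using small[of B] call w call_bound_ge_2 by (auto simp: focus_inv_def weight_inv_def)
  then show ?thesis using call w c
    by (auto simp: weight_inv_def call_inv_def algebra_simps intro!: exI[of _ 0])
next
  case (iteration x B g w')
  obtain r where r: "real k + call_bound \<le> call_bound * real c + real r"
    and f: "focus_inv r (cong s) x B"
    using c iteration by (auto simp: call_inv_def)
  have cc: "cong s \<in> carrier_vec m" "wt s \<in> carrier_vec m" using w by (auto simp: weight_inv_def)
  have lt: "cong s $ i < \<eta>" if "i < m" for i
    using congestion_lt[OF _ cc(1) that] iteration by simp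
  from f have x: "x \<in> carrier_vec N" "\<forall>j<N. 0 \<le> x $ j" and B: "B \<subseteq> {..<N}"
    by (auto simp: focus_inv_def)
  note g = focus_increment_bounds[OF \<open>focus_increment A \<epsilon> x B g\<close> x B]
  have Ag: "0 \<le> (A *\<^sub>v g) $ i" if "i < m" for i
    using mult_vec_nonneg[OF g(1) _ that] g(2) by blast
  have w'c: "w' \<in> carrier_vec m" using iteration by simp
  have w'i: "w' $ i = wt s $ i * (1 + (A *\<^sub>v g) $ i)" if "i < m" for i
    using iteration that by simp
  have wpos: "0 \<le> wt s $ i" and wexp: "wt s $ i \<le> exp (cong s $ i)"
    and cpos: "0 \<le> cong s $ i" if "i < m" for i
    using w that by (auto simp: weight_inv_def)
  \<comment> \<open>Weights never decrease, so \<lambda> remains a lower bound for all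
    loads.\<close>
  have mono: "wt s $ i \<le> w' $ i" if "i < m" for i
    unfolding w'i[OF that] using Ag[OF that] wpos[OF that]
    by (simp add: mult_le_cancel_left1 not_less)
  have exp': "w' $ i \<le> exp ((cong s + A *\<^sub>v g) $ i)" if "i < m" for i
  proof -
    \<comment> \<open>The factor \<open>1 + t\<close> of the weight update is at most
      \<open>exp t\<close>, which matches the additive update of the congestion.\<close>
    have "w' $ i \<le> exp (cong s $ i) * exp ((A *\<^sub>v g) $ i)"
      unfolding w'i[OF that] using wexp[OF that] Ag[OF that]
      by (intro mult_mono exp_ge_add_one_self) auto
    then show ?thesis using that cc(1) by (simp add: exp_add)
  qed
  have "lam s \<le> (transpose_mat A *\<^sub>v w') $ j" if "j < N" for j
    using load_mono[OF cc(2) w'c mono that] w that by (force simp: weight_inv_def)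
  moreover have "0 \<le> (cong s + A *\<^sub>v g) $ i \<and> (cong s + A *\<^sub>v g) $ i \<le> \<eta> + \<epsilon>" if "i < m" for i
    using lt[OF that] g(3)[OF that] Ag[OF that] cpos[OF that] that cc by simp
  moreover have "0 \<le> w' $ i" if "i < m" for i
    using mono[OF that] wpos[OF that] by simp
  moreover have "cong s + A *\<^sub>v g \<in> carrier_vec m"
    using cc(1) A_carrier g(1) by (intro add_carrier_vec mult_mat_vec_carrier)
  ultimately have "weight_inv e s'"
    using exp' w w'c unfolding weight_inv_def iteration(2) by simp
  moreover have "call_inv c (Suc k) s'"
  proof -
    have "focus_inv (Suc r) (cong s + A *\<^sub>v g) (x + g) (B \<inter> light_cols A \<epsilon> (lam s) w')"
      using iteration by (intro focus_inv_step[OF f cc(1) lt]) auto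
    then show ?thesis using r unfolding call_inv_def iteration(2)
      by (auto intro!: exI[of _ "Suc r"])
  qed
  ultimately show ?thesis using iteration(1) by simp
next
  case (return x B)
  \<comment> \<open>On return, \<open>r \<le> call_bound\<close> from \<open>focus_inv\<close>
    closes the account of the call.\<close>
  then show ?thesis using w c by (auto simp: weight_inv_def call_inv_def focus_inv_def)
next
  case (new_epoch L' y')
  \<comment> \<open>The failed test of the outer loop says exactly that the new \<lambda> is still a
    lower bound for all loads.\<close>
  then have "L' \<le> (transpose_mat A *\<^sub>v wt s) $ j" if "j < N" for j
    using min_load_le[OF that, of "wt s"] by linarith
  then show ?thesis using w c new_epoch by (auto simp: weight_inv_def call_inv_def)
next
  case halt
  then show ?thesis using w c by simp
qed

text \<open>The comparison is made in a column of minimal initial load. Its load has grown by a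
  factor of at most \<open>exp (\<eta> + \<epsilon>)\<close> and still dominates \<lambda>, which
  began at that very load.\<close>

lemma epochs_le:
  assumes "weight_inv e s"
  shows "real e \<le> (\<eta> + \<epsilon>) / ln (1 + \<epsilon>)"
proof -
  obtain j where j: "j < N" "init_lam = (transpose_mat A *\<^sub>v ones m) $ j"
    unfolding init_lam_def by (rule min_load_attained)
  have wc: "wt s \<in> carrier_vec m" using assms by (simp add: weight_inv_def)
  have "init_lam * (1 + \<epsilon>) ^ e \<le> (transpose_mat A *\<^sub>v wt s) $ j"
    using assms j by (force simp: weight_inv_def)
  also have "\<dots> \<le> (\<Sum>i<m. A $$ (i, j) * exp (\<eta> + \<epsilon>))"
    unfolding transpose_mult_vec_nth_sum[OF A_carrier wc j(1)]
  proof (intro sum_mono mult_left_mono)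
    fix i assume "i \<in> {..<m}"
    then have "wt s $ i \<le> exp (cong s $ i)" "exp (cong s $ i) \<le> exp (\<eta> + \<epsilon>)"
      using assms by (auto simp: weight_inv_def)
    then show "wt s $ i \<le> exp (\<eta> + \<epsilon>)" by linarith
  qed (use entry_nonneg j in auto)
  also have "\<dots> = init_lam * exp (\<eta> + \<epsilon>)"
    using j ones_load by (simp add: sum_distrib_right)
  finally have "(1 + \<epsilon>) ^ e \<le> exp (\<eta> + \<epsilon>)" using init_lam_pos by simp
  then show ?thesis using power_le_imp_exponent_le[of "1 + \<epsilon>" e "exp (\<eta> + \<epsilon>)"] eps_pos by simp
qed

section \<open>Counting epochs, calls and iterations of an execution\<close>

context
  fixes \<sigma> :: "nat \<Rightarrow> alg_state" and \<alpha> :: "nat \<Rightarrow> action" and l :: nat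
  assumes exec: "execution A \<epsilon> \<sigma> \<alpha>"
    and core: "always_follows_core_sequences A \<epsilon> \<sigma> \<alpha> l n"
begin

abbreviation epochs :: "nat \<Rightarrow> nat" where
  "epochs \<equiv> occurrences (\<lambda>a. a = New_Epoch) \<alpha>"

abbreviation calls :: "nat \<Rightarrow> nat" where
  "calls \<equiv> occurrences (\<lambda>a. \<exists>B. a = Call B) \<alpha>"

abbreviation focus_iterations :: "nat \<Rightarrow> nat" where
  "focus_iterations \<equiv> occurrences (\<lambda>a. a = Iteration) \<alpha>"

lemma selected_card_le: "\<alpha> t = Call B \<Longrightarrow> card B \<le> n"
  using core selects_imp(3)[of \<sigma> \<alpha> "lam (\<sigma> t)" _ t B]
  unfolding always_follows_core_sequences_def follows_core_sequence_def by blast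

text \<open>Allowing values \<open>L\<close> that are never attained, where there are no calls,
  makes the bound available for every \<open>init_lam * (1 + \<epsilon>) ^ e\<close>.\<close>

lemma call_times_bound: "finite (call_times \<sigma> \<alpha> L) \<and> card (call_times \<sigma> \<alpha> L) \<le> l"
proof (cases "L \<in> range (\<lambda>t. lam (\<sigma> t))")
  case True
  then obtain Bs where "selects \<sigma> \<alpha> L Bs" "length Bs \<le> l"
    using core unfolding always_follows_core_sequences_def follows_core_sequence_def by blast
  then show ?thesis using selects_imp(1,2) le_trans by blast
next
  case False
  then have "call_times \<sigma> \<alpha> L = {}" by (auto simp: call_times_def)
  then show ?thesis by simp
qed

lemma execution_inv:
  "weight_inv (epochs t) (\<sigma> t) \<and> call_inv (calls t) (focus_iterations t) (\<sigma> t)"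
proof (induction t)
  case 0
  then show ?case using exec weight_inv_init call_inv_init by (simp add: execution_def)
next
  case (Suc t)
  have "alg_step A \<epsilon> (\<sigma> t) (\<alpha> t) (\<sigma> (Suc t))" using exec by (simp add: execution_def)
  from inv_step[OF this conjunct1[OF Suc] conjunct2[OF Suc] selected_card_le]
  show ?case by simp
qed

lemma epochs_mono: "u \<le> t \<Longrightarrow> epochs u \<le> epochs t"
  unfolding occurrences_def by (intro card_mono) auto

text \<open>A call at time \<open>u\<close> belongs to the epoch with exponent
  \<open>epochs u\<close>. The exponents run from 0 to \<open>epochs t\<close>, hence the
  \<open>+ 1\<close>.\<close>

lemma calls_le: "calls t \<le> l * (epochs t + 1)"
proof -
  let ?C = "\<lambda>e. call_times \<sigma> \<alpha> (init_lam * (1 + \<epsilon>) ^ e)"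
  have "{u. u < t \<and> (\<exists>B. \<alpha> u = Call B)} \<subseteq> (\<Union>e\<in>{..epochs t}. ?C e)"
  proof
    fix u assume "u \<in> {u. u < t \<and> (\<exists>B. \<alpha> u = Call B)}"
    then have "u \<in> ?C (epochs u)" "epochs u \<le> epochs t"
      using execution_inv[of u] epochs_mono[of u t] by (auto simp: call_times_def weight_inv_def)
    then show "u \<in> (\<Union>e\<in>{..epochs t}. ?C e)" by blast
  qed
  then have "calls t \<le> card (\<Union>e\<in>{..epochs t}. ?C e)"
    unfolding occurrences_def using call_times_bound by (intro card_mono) auto
  also have "\<dots> \<le> (\<Sum>e\<in>{..epochs t}. card (?C e))" by (rule card_UN_le) simp
  also have "\<dots> \<le> (\<Sum>e\<in>{..epochs t}. l)" using call_times_bound by (intro sum_mono) simp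
  finally show ?thesis by (simp add: mult.commute)
qed

lemma focus_iterations_le: "real (focus_iterations t) \<le> call_bound * real (calls t)"
  using execution_inv[of t]
  by (auto simp: call_inv_def focus_inv_def split: option.splits)

text \<open>The run must open with a call: the congestion is 0, and the minimal load equals
  \<lambda>, so the first epoch is not cleared. This lets the number of epochs be absorbed into a
  multiple of \<open>l\<close>.\<close>

lemma l_pos: "0 < l"
proof -
  have "alg_step A \<epsilon> (init_state A) (\<alpha> 0) (\<sigma> (Suc 0))"
    using exec unfolding execution_def by metis
  moreover have "linf_norm (0\<^sub>v m) < \<eta>"
  proof (rule linf_norm_attained)
    show "0 < dim_vec (0\<^sub>v m :: real vec)" using m_ge_2 by simp
  qed (use eta_pos in simp)
  moreover have "init_lam < (1 + \<epsilon>) * init_lam" using init_lam_pos eps_pos by simp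
  ultimately have "\<exists>B. \<alpha> 0 = Call B"
    by cases (auto simp: init_state_def Let_def init_lam_def)
  then have "0 \<in> call_times \<sigma> \<alpha> (lam (\<sigma> 0))" by (simp add: call_times_def)
  then show ?thesis using call_times_bound[of "lam (\<sigma> 0)"]
    by (metis card_0_eq empty_iff gr0I le_zero_eq)
qed

lemma iteration_times_bound:
  defines "K \<equiv> (\<eta> + \<epsilon>) / ln (1 + \<epsilon>)"
  shows "finite (iteration_times \<alpha>) \<and>
         real (card (iteration_times \<alpha>)) \<le> 2 * (real l * call_bound * (K + 1))"
proof -
  have "real (occurrences (\<lambda>a. a = Iteration \<or> a = New_Epoch) \<alpha> t)
      \<le> 2 * (real l * call_bound * (K + 1))" for t
  proof -
    have split: "occurrences (\<lambda>a. a = Iteration \<or> a = New_Epoch) \<alpha> t = focus_iterations t + epochs t"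
      by (induction t) auto
    have e: "real (epochs t) \<le> K"
      unfolding K_def using execution_inv epochs_le by blast
    have "real (calls t) \<le> real l * (real (epochs t) + 1)"
      using calls_le[of t] by (metis of_nat_1 of_nat_add of_nat_le_iff of_nat_mult)
    also have "\<dots> \<le> real l * (K + 1)" using e by (intro mult_left_mono) auto
    finally have "call_bound * real (calls t) \<le> call_bound * (real l * (K + 1))"
      using call_bound_ge_2 by (intro mult_left_mono) auto
    \<comment> \<open>The epoch changes fit into a second copy of the bound for the Focus
      iterations, whence the factor 2.\<close>
    moreover have "1 * (K + 1) \<le> (real l * call_bound) * (K + 1)"
    proof (intro mult_right_mono)
      have "1 * 1 \<le> real l * call_bound"
        using l_pos call_bound_ge_2 by (intro mult_mono) auto
      then show "1 \<le> real l * call_bound" by simp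
    qed (use e in linarith)
    ultimately show ?thesis using split e focus_iterations_le[of t] by (simp add: algebra_simps)
  qed
  from finite_card_le_if_occurrences_le[OF this] show ?thesis by (simp add: iteration_times_def)
qed

end

end

section \<open>Absorbing lower-order terms into a constant\<close>

theorem theorem3p7:
  fixes E \<kappa> :: real
  assumes "E > 0" and "\<kappa> > 1"
  shows "\<exists>C>0. \<forall>(m::nat) (N::nat) (A::real mat) (\<epsilon>::real) (l::nat) (n::nat)
           (\<sigma>::nat \<Rightarrow> alg_state) (\<alpha>::nat \<Rightarrow> action).
           A \<in> carrier_mat m N \<longrightarrow> N > 0 \<longrightarrow> nonneg_mat A \<longrightarrow> no_zero_col A \<longrightarrow>
           0 < \<epsilon> \<longrightarrow> \<epsilon> \<le> E \<longrightarrow> \<kappa> \<le> eta m \<epsilon> * real n / \<epsilon> \<longrightarrow>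
           execution A \<epsilon> \<sigma> \<alpha> \<longrightarrow> always_follows_core_sequences A \<epsilon> \<sigma> \<alpha> l n \<longrightarrow>
           finite (iteration_times \<alpha>) \<and>
           real (card (iteration_times \<alpha>))
             \<le> C * (real l * (ln (real m))\<^sup>2 * ln (eta m \<epsilon> * real n / \<epsilon>) / \<epsilon> ^ 4)"
proof -
  \<comment> \<open>\<open>D\<close> bounds \<open>\<epsilon>\<^sup>2 / ln m\<close>, using
    \<open>\<epsilon> \<le> E\<close> and \<open>m \<ge> 2\<close>. \<open>C1\<close> is the
    constant for the iterations per call and \<open>C2\<close> the one for the epochs.\<close>
  define D where "D = E\<^sup>2 / ln 2"
  define C1 where "C1 = 1 + (1 + 2 / ln \<kappa>) * D"
  define C2 where "C2 = (1 + D) * (1 + E) + D"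
  have D: "0 < D" using assms by (simp add: D_def)
  have C1: "0 < C1" using D assms by (simp add: C1_def add_pos_nonneg)
  have C2: "0 < C2" using D assms by (simp add: C2_def add_pos_pos)
  show ?thesis
  proof (intro exI[of _ "2 * (C1 * C2)"] conjI allI impI)
    show "0 < 2 * (C1 * C2)" using C1 C2 by simp
    fix m N :: nat and A :: "real mat" and \<epsilon> :: real and l n :: nat
      and \<sigma> :: "nat \<Rightarrow> alg_state" and \<alpha> :: "nat \<Rightarrow> action"
    assume inst: "A \<in> carrier_mat m N" "0 < N" "nonneg_mat A" "no_zero_col A" "0 < \<epsilon>"
      and \<epsilon>E: "\<epsilon> \<le> E" and \<kappa>: "\<kappa> \<le> eta m \<epsilon> * real n / \<epsilon>"
      and run: "execution A \<epsilon> \<sigma> \<alpha>" "always_follows_core_sequences A \<epsilon> \<sigma> \<alpha> l n"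
    interpret focus_instance m N n A \<epsilon>
      using inst less_le_trans[OF assms(2) \<kappa>] by (rule focus_instance.intro)
    define a where "a = ln (real m)"
    define G where "G = ln (eta m \<epsilon> * real n / \<epsilon>)"
    \<comment> \<open>This is \<open>\<eta> / \<epsilon>\<close>, the common scale of both
      estimates: the growth rate within a call is \<open>1 + 1 / y\<close>.\<close>
    define y where "y = a / \<epsilon>\<^sup>2"
    define K where "K = (eta m \<epsilon> + \<epsilon>) / ln (1 + \<epsilon>)"
    have bound: "finite (iteration_times \<alpha>)"
        "real (card (iteration_times \<alpha>)) \<le> 2 * (real l * call_bound * (K + 1))"
      using iteration_times_bound[OF run] by (auto simp: K_def)
    have a: "ln 2 \<le> a" "0 < a" using m_ge_2 ln_m_pos by (auto simp: a_def)
    have G: "ln \<kappa> \<le> G" "0 < ln \<kappa>" using \<kappa> assms(2) ratio_gt_1 by (auto simp: G_def)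
    have y: "0 < y" using a inst by (simp add: y_def)
    have "\<epsilon>\<^sup>2 / a \<le> D"
      unfolding D_def using \<epsilon>E inst a by (intro frac_le power_mono) auto
    then have Dy: "1 \<le> D * y" using a inst by (simp add: y_def field_simps)
    have "call_bound = 2 + G * (1 / ln (1 + 1 / y))"
      by (simp add: call_bound_def G_def y_def a_def eta_def power2_eq_square)
    also have "\<dots> \<le> 2 + G * (1 + y)"
      using inverse_ln_one_plus_le[of "1 / y"] y G by (intro add_left_mono mult_left_mono) auto
    \<comment> \<open>The additive 2 becomes a multiple of \<open>G\<close> because
      \<open>G \<ge> ln \<kappa> > 0\<close>; a bound \<kappa> above 1 keeps this multiple
      uniform.\<close>
    also have "2 \<le> G * (2 / ln \<kappa>)" using G by (simp add: field_simps)
    also have "G * (2 / ln \<kappa>) + G * (1 + y) = G * ((1 + 2 / ln \<kappa>) * 1 + y)"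
      by (simp add: algebra_simps)
    \<comment> \<open>Constants become multiples of \<open>y\<close> through
      \<open>1 \<le> D * y\<close>.\<close>
    also have "\<dots> \<le> G * ((1 + 2 / ln \<kappa>) * (D * y) + y)"
      using G Dy by (intro mult_left_mono add_right_mono) auto
    also have "\<dots> = C1 * (G * y)" by (simp add: C1_def algebra_simps)
    finally have P: "call_bound \<le> C1 * (G * y)" by simp
    have "K = (eta m \<epsilon> + \<epsilon>) * (1 / ln (1 + \<epsilon>))" by (simp add: K_def)
    also have "\<dots> \<le> (eta m \<epsilon> + \<epsilon>) * (1 + 1 / \<epsilon>)"
      using inst eta_pos by (intro mult_left_mono inverse_ln_one_plus_le) auto
    also have "\<dots> = (y + 1) * (1 + \<epsilon>)"
      using inst by (simp add: y_def eta_def a_def field_simps power2_eq_square)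
    also have "\<dots> \<le> (y + D * y) * (1 + E)"
      using Dy y \<epsilon>E inst by (intro mult_mono) auto
    finally have K: "K + 1 \<le> C2 * y" using Dy by (simp add: C2_def algebra_simps)
    have K_nonneg: "0 \<le> K" using eta_pos inst by (simp add: K_def)
    have "call_bound * (K + 1) \<le> (C1 * (G * y)) * (C2 * y)"
      using P K K_nonneg call_bound_ge_2 C1 G y by (intro mult_mono) auto
    then have "real l * (call_bound * (K + 1)) \<le> real l * ((C1 * (G * y)) * (C2 * y))"
      by (intro mult_left_mono) auto
    \<comment> \<open>One factor \<open>y\<close> comes from the calls and one from the epochs;
      their product is \<open>a\<^sup>2 / \<epsilon> ^ 4\<close>.\<close>
    also have "\<dots> = C1 * C2 * (real l * a\<^sup>2 * G / \<epsilon> ^ 4)"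
      by (simp add: y_def power2_eq_square power4_eq_xxxx mult_ac)
    finally show "real (card (iteration_times \<alpha>))
        \<le> 2 * (C1 * C2) * (real l * (ln (real m))\<^sup>2 * ln (eta m \<epsilon> * real n / \<epsilon>) / \<epsilon> ^ 4)"
      using bound(2) by (simp add: a_def G_def mult.assoc)
    show "finite (iteration_times \<alpha>)" by (fact bound(1))
  qed
qed

end
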